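(* Let $\mathcal F=\{S_1,\ldots,S_m\}$, $2\le m<n+2$, be an S-family of spheres in $\mathbb R^n$, and let $d:=n+2-m$. Then any spherical $\psi_{\mathcal F}$-code $X$ in $\mathbb S^{d-1}$ uniquely determines the set of equivalent $\mathcal F$-kissing arrangements $\{P_A(X)\}$ such that this set can be parametrized by $A\in \mathrm{SO}(d)$. Moreover, for any isometric $\psi_{\mathcal F}$-codes $X$ and $Y$ in $\mathbb S^{d-1}$ and any $A,B\in \mathrm{SO}(d)$, the arrangement $P_A(X)$ can be transformed to $P_B(Y)$ by a conformal map.
   Context: Two distinct spheres in $\mathbb R^n$ are called non-intersecting if their intersection is not a sphere of radius $r>0$, i.e. they are either disjoint or touch each other. Let $\mathcal F=\{S_1,\ldots,S_m\}$ be a family of $m$ arbitrary spheres in $\mathbb R^n$ (each $S_i$ can be a sphere of any radius or a hyperplane). A set $\mathcal C$ of spheres in $\mathbb R^n$ is an $\mathcal F$-kissing arrangement if (1) each sphere from $\mathcal C$ is tangent to all spheres from $\mathcal F$; (2) each sphere from $\mathcal C$ is tangent to at least one sphere from $\mathcal C$; (3) any two distinct spheres from $\mathcal C$ are non-intersecting. The family $\mathcal F$, $m\ge 2$, is an S-family if (1) $S_1$ and $S_2$ are non-intersecting spheres; (2) each $S_i$ with $i>2$ can intersect at most one $S_j$ with $j=1,2$; (3) there are non-empty $\mathcal F$-kissing arrangements and all of them are finite. A set $X$ of points in the unit sphere $\mathbb S^{d-1}$ is a spherical $\psi$-code if the angular distance between distinct points of $X$ is at least $\psi$. Definition of $\psi_{\mathcal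 F}$ and of the correspondence $\Phi_{\mathcal F}$ between $\mathcal F$-kissing arrangements and spherical $\psi_{\mathcal F}$-codes. Let $T$ be an inversion (followed by a rescaling) such that $S'_1:=T(S_1)$ and $S'_2:=T(S_2)$ are two parallel hyperplanes if $S_1,S_2$ are tangent (the center of inversion being their contact point), and two concentric spheres otherwise, normalized so that the images under $T$ of the spheres of $\mathcal F$-kissing arrangements (which are all congruent) are unit spheres. Put $S'_i:=T(S_i)$, and let $r_i$ be the radius of $S'_i$. Let $Z_0$ be the hyperplane of symmetry of $S'_1$ and $S'_2$ in the tangent case, and the sphere of radius $(r_1+r_2)/2$ concentric with $S'_1,S'_2$ in the other case. For $3\le i\le m$ let $Z_i$ be the sphere of radius $r_i+1$ concentric with $S'_i$. Let $S_{\mathcal F}$ be the locus of centers of the unit spheres tangent to all $S'_i$: $S_{\mathcal F}=Z_0$ if $m=2$, and $S_{\mathcal F}=Z_0\cap Z_3\cap\cdots\cap Z_m$ if $m>2$. It is a $(d-1)$-dimensional sphere of some radius $r>0$. If $r\ge 1$, put $\psi_{\mathcal F}:=\arccos\left(1-\frac{2}{r^2}\right)$; if $r<1$, $\psi_{\mathcal F}$ is any number greater than $\pi$. Let $f$ be the central projection of $S_{\mathcal F}$ onto the concentric unit sphere $U_{\mathcal F}$, identified with $\mathbb S^{d-1}$. For an $\mathcal F$-kissing arrangement $P$, $\Phi_{\mathcal F}(P):=f(c_P)$, where $c_P$ is the set of centers of the spheres in $T(P)$; in the other direction, a code $X$ is sent to $T^{-1}(Q_X)$, where $Q_X$ is the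 set of unit spheres with centers in $f^{-1}(X)$. Two $\mathcal F$-kissing arrangements $M$ and $N$ are equivalent if the corresponding spherical $\psi_{\mathcal F}$-codes $\Phi_{\mathcal F}(M)$ and $\Phi_{\mathcal F}(N)$ are isometric in $\mathbb S^{d-1}$. For a $\psi_{\mathcal F}$-code $X$ and $A\in \mathrm{SO}(d)$, $P_A(X):=T^{-1}(Q_{A(X)})$ denotes the arrangement corresponding to the rotated code $A(X)$.
   Formalization: P_A(X) always meets (1) and (3), but is F-kissing iff each point of X has another at angle exactly ψ_F (a one-point code fails (2)); that S_F is a (d-1)-sphere is assumed, as it can fail; converse clauses cover only arrangements whose T-images are unit spheres centred on S_F. *)

theory Defs
  imports "HOL-Analysis.Analysis"
begin

text \<open>
  Spheres live in the one-point compactification of the ambient space, modelled by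
  \<^typ>\<open>'a option\<close> with \<^term>\<open>None\<close> as the point at infinity. A hyperplane contains
  the point at infinity, so parallel hyperplanes touch each other there, and inversions are
  bijections that map spheres to spheres and preserve tangency.
\<close>

definition proper_sphere :: "'a::euclidean_space \<Rightarrow> real \<Rightarrow> 'a option set" where
  "proper_sphere c r = Some ` sphere c r"

definition plane :: "'a::euclidean_space \<Rightarrow> real \<Rightarrow> 'a option set" where
  "plane a b = insert None (Some ` {x. a \<bullet> x = b})"

definition is_sphere :: "'a::euclidean_space option set \<Rightarrow> bool" where
  "is_sphere C \<longleftrightarrow> (\<exists>c r. r > 0 \<and> C = proper_sphere c r) \<or> (\<exists>a b. a \<noteq> 0 \<and> C = plane a b)"

definition tangent :: "'a option set \<Rightarrow> 'a option set \<Rightarrow> bool" where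
  "tangent C D \<longleftrightarrow> (\<exists>p. C \<inter> D = {p})"

definition non_intersecting :: "'a option set \<Rightarrow> 'a option set \<Rightarrow> bool" where
  "non_intersecting C D \<longleftrightarrow> C \<noteq> D \<and> (C \<inter> D = {} \<or> tangent C D)"

definition tangent_to_all :: "'a option set set \<Rightarrow> 'a option set set \<Rightarrow> bool" where
  "tangent_to_all F P \<longleftrightarrow> (\<forall>C\<in>P. \<forall>D\<in>F. tangent C D)"

definition pairwise_non_intersecting :: "'a option set set \<Rightarrow> bool" where
  "pairwise_non_intersecting P \<longleftrightarrow> (\<forall>C\<in>P. \<forall>D\<in>P. C \<noteq> D \<longrightarrow> non_intersecting C D)"

definition kissing_arrangement ::
    "'a::euclidean_space option set set \<Rightarrow> 'a option set set \<Rightarrow> bool" where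
  "kissing_arrangement F P \<longleftrightarrow>
     (\<forall>C\<in>P. is_sphere C) \<and> tangent_to_all F P \<and>
     (\<forall>C\<in>P. \<exists>D\<in>P. tangent C D) \<and> pairwise_non_intersecting P"

definition family :: "(nat \<Rightarrow> 'a option set) \<Rightarrow> nat \<Rightarrow> 'a option set set" where
  "family S m = S ` {1..m}"

definition S_family :: "(nat \<Rightarrow> 'a::euclidean_space option set) \<Rightarrow> nat \<Rightarrow> bool" where
  "S_family S m \<longleftrightarrow>
     m \<ge> 2 \<and> (\<forall>i\<in>{1..m}. is_sphere (S i)) \<and>
     non_intersecting (S 1) (S 2) \<and>
     (\<forall>i\<in>{3..m}. non_intersecting (S i) (S 1) \<or> non_intersecting (S i) (S 2)) \<and>
     (\<exists>P. P \<noteq> {} \<and> kissing_arrangement (family S m) P) \<and>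
     (\<forall>P. kissing_arrangement (family S m) P \<longrightarrow> finite P)"


text \<open>The inversion centred at infinity is the identity. It is needed when the first two spheres
  of the family are parallel hyperplanes, whose contact point is infinity.\<close>

definition inversion :: "'a::euclidean_space option \<Rightarrow> real \<Rightarrow> 'a option \<Rightarrow> 'a option" where
  "inversion p \<rho> q =
     (case p of None \<Rightarrow> q
      | Some c \<Rightarrow>
          (case q of None \<Rightarrow> Some c
           | Some x \<Rightarrow> if x = c then None
                       else Some (c + (\<rho>\<^sup>2 / (norm (x - c))\<^sup>2) *\<^sub>R (x - c))))"

definition rescaling :: "real \<Rightarrow> 'a::euclidean_space option \<Rightarrow> 'a option" where
  "rescaling t = map_option (\<lambda>x. t *\<^sub>R x)"

text \<open>The normalisation to unit spheres: a sphere lying between the images of the first two spheres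
  and touching both has radius one exactly if the gap between these images is two.\<close>

definition normalizing ::
    "'a::euclidean_space option set \<Rightarrow> 'a option set \<Rightarrow> ('a option \<Rightarrow> 'a option) \<Rightarrow> bool" where
  "normalizing S1 S2 T \<longleftrightarrow>
     (\<exists>p \<rho> t. \<rho> > 0 \<and> t > 0 \<and> T = rescaling t \<circ> inversion p \<rho> \<and>
        (if tangent S1 S2
         then S1 \<inter> S2 = {p} \<and>
           (\<exists>a b c. norm a = 1 \<and> \<bar>b - c\<bar> = 2 \<and> T ` S1 = plane a b \<and> T ` S2 = plane a c)
         else (\<exists>q r1 r2. r1 > 0 \<and> r2 > 0 \<and> \<bar>r1 - r2\<bar> = 2 \<and>
                 T ` S1 = proper_sphere q r1 \<and> T ` S2 = proper_sphere q r2)))"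

definition Z0 :: "'a::euclidean_space option set \<Rightarrow> 'a option set \<Rightarrow> 'a set" where
  "Z0 S1 S2 =
     {x. (\<exists>a b c. norm a = 1 \<and> S1 = plane a b \<and> S2 = plane a c \<and> a \<bullet> x = (b + c) / 2) \<or>
         (\<exists>q r1 r2. r1 > 0 \<and> r2 > 0 \<and> S1 = proper_sphere q r1 \<and> S2 = proper_sphere q r2 \<and>
            x \<in> sphere q ((r1 + r2) / 2))}"

definition Z :: "'a::euclidean_space option set \<Rightarrow> 'a set" where
  "Z C = {x. \<exists>q \<rho>. \<rho> > 0 \<and> C = proper_sphere q \<rho> \<and> x \<in> sphere q (\<rho> + 1)}"

text \<open>The set of centres is described in two ways: as the locus of the centres of all
  unit spheres tangent to the images, and as an intersection of spheres. They agree for externally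
  touching spheres, but differ if a unit sphere touches an image from inside or if an image is
  a hyperplane. Either description is admitted.\<close>

definition center_set ::
    "(nat \<Rightarrow> 'a::euclidean_space option set) \<Rightarrow> nat \<Rightarrow> 'a set \<Rightarrow> bool" where
  "center_set S' m L \<longleftrightarrow>
     L = {x. \<forall>i\<in>{1..m}. tangent (proper_sphere x 1) (S' i)} \<or>
     L = Z0 (S' 1) (S' 2) \<inter> (\<Inter>i\<in>{3..m}. Z (S' i))"

text \<open>\<^term>\<open>L\<close> is a sphere with centre \<^term>\<open>z\<close> and radius \<^term>\<open>r\<close>, of dimension one less than that
  of \<^typ>\<open>'b\<close>; the linear isometry \<^term>\<open>\<iota>\<close> identifies the concentric unit sphere with the unit
  sphere of \<^typ>\<open>'b\<close> through \<open>x \<mapsto> z + \<iota> x\<close>.\<close>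

definition sphere_frame ::
    "'a::euclidean_space set \<Rightarrow> 'a \<Rightarrow> real \<Rightarrow> ('b::euclidean_space \<Rightarrow> 'a) \<Rightarrow> bool" where
  "sphere_frame L z r \<iota> \<longleftrightarrow>
     r > 0 \<and> linear \<iota> \<and> (\<forall>x. norm (\<iota> x) = norm x) \<and>
     L = (\<lambda>x. z + r *\<^sub>R \<iota> x) ` sphere 0 1"

text \<open>For \<open>r < 1\<close> the angle is an arbitrary number greater than \<open>\<pi>\<close>, hence a relation.\<close>

definition code_angle :: "real \<Rightarrow> real \<Rightarrow> bool" where
  "code_angle r \<psi> \<longleftrightarrow> (if r \<ge> 1 then \<psi> = arccos (1 - 2 / r\<^sup>2) else \<psi> > pi)"


definition angular_dist :: "'b::euclidean_space \<Rightarrow> 'b \<Rightarrow> real" where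
  "angular_dist x y = arccos (x \<bullet> y)"

definition spherical_code :: "real \<Rightarrow> 'b::euclidean_space set \<Rightarrow> bool" where
  "spherical_code \<psi> X \<longleftrightarrow>
     X \<subseteq> sphere 0 1 \<and> (\<forall>x\<in>X. \<forall>y\<in>X. x \<noteq> y \<longrightarrow> angular_dist x y \<ge> \<psi>)"

definition isometric_on_sphere :: "'b::euclidean_space set \<Rightarrow> 'b set \<Rightarrow> bool" where
  "isometric_on_sphere X Y \<longleftrightarrow>
     (\<exists>g. g ` sphere 0 1 = sphere 0 1 \<and>
          (\<forall>x\<in>sphere 0 1. \<forall>y\<in>sphere 0 1. dist (g x) (g y) = dist x y) \<and> g ` X = Y)"


text \<open>Central projection to the concentric unit sphere, followed by its identification with the
  unit sphere of \<^typ>\<open>'b\<close>.\<close>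

definition proj :: "'a::euclidean_space \<Rightarrow> ('b::euclidean_space \<Rightarrow> 'a) \<Rightarrow> 'a \<Rightarrow> 'b" where
  "proj z \<iota> y = inv \<iota> (sgn (y - z))"

definition Phi ::
    "('a::euclidean_space option \<Rightarrow> 'a option) \<Rightarrow> 'a \<Rightarrow> ('b::euclidean_space \<Rightarrow> 'a) \<Rightarrow>
     'a option set set \<Rightarrow> 'b set" where
  "Phi T z \<iota> P = proj z \<iota> ` {y. \<exists>C\<in>P. \<exists>\<rho>>0. T ` C = proper_sphere y \<rho>}"

definition arrangement_of_code ::
    "('a::euclidean_space option \<Rightarrow> 'a option) \<Rightarrow> 'a set \<Rightarrow> 'a \<Rightarrow> ('b::euclidean_space \<Rightarrow> 'a) \<Rightarrow>
     'b set \<Rightarrow> 'a option set set" where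
  "arrangement_of_code T L z \<iota> X =
     (\<lambda>y. inv T ` proper_sphere y 1) ` {y \<in> L. proj z \<iota> y \<in> X}"

definition rotated_arrangement ::
    "('a::euclidean_space option \<Rightarrow> 'a option) \<Rightarrow> 'a set \<Rightarrow> 'a \<Rightarrow> (real ^ 'd \<Rightarrow> 'a) \<Rightarrow>
     (real ^ 'd) set \<Rightarrow> real ^ 'd ^ 'd \<Rightarrow> 'a option set set" where
  "rotated_arrangement T L z \<iota> X A = arrangement_of_code T L z \<iota> ((*v) A ` X)"

definition equivalent_arrangements ::
    "('a::euclidean_space option \<Rightarrow> 'a option) \<Rightarrow> 'a \<Rightarrow> ('b::euclidean_space \<Rightarrow> 'a) \<Rightarrow>
     'a option set set \<Rightarrow> 'a option set set \<Rightarrow> bool" where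
  "equivalent_arrangements T z \<iota> M N \<longleftrightarrow> isometric_on_sphere (Phi T z \<iota> M) (Phi T z \<iota> N)"

text \<open>The domain of the correspondence: arrangements whose images consist of unit spheres with
  centres in \<^term>\<open>L\<close>. The defining conditions of a kissing arrangement alone do not
  exclude spheres of another size: two concentric spheres are also touched
  by spheres that enclose the inner one.\<close>

definition congruent_arrangement ::
    "('a::euclidean_space option \<Rightarrow> 'a option) \<Rightarrow> 'a set \<Rightarrow> 'a option set set \<Rightarrow> bool" where
  "congruent_arrangement T L P \<longleftrightarrow> (\<forall>C\<in>P. \<exists>y\<in>L. T ` C = proper_sphere y 1)"


text \<open>Conformality of a self-map of the compactified space: in the chart at each point (the
  identity at finite points, the unit inversion at infinity), the derivative scales the inner
  product by a positive factor. Orientation may be reversed.\<close>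

definition chart :: "'a::euclidean_space option \<Rightarrow> 'a option \<Rightarrow> 'a option" where
  "chart p = (if p = None then inversion (Some 0) 1 else id)"

definition conformal_map :: "('a::euclidean_space option \<Rightarrow> 'a option) \<Rightarrow> bool" where
  "conformal_map g \<longleftrightarrow> bij g \<and>
     (\<forall>p. \<exists>D k. k > 0 \<and>
        ((\<lambda>x. the (chart (g p) (g (chart p (Some x))))) has_derivative D)
          (at (the (chart p p))) \<and>
        (\<forall>u v. D u \<bullet> D v = k * (u \<bullet> v)))"

end

theory Submission
  imports Defs
begin

text \<open>
  The normalising map \<open>T\<close> turns the arrangements into sets of unit spheres with centres on the sphere
  \<open>L\<close> of radius \<open>r\<close>. Two such spheres do not intersect iff their centres are at distance at least 2,
  and by the law of cosines this means that the projected centres have angular distance at least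
  \<open>arccos (1 - 2 / r\<^sup>2)\<close>, with equality exactly for tangent spheres. An isometry between two codes is
  induced by an orthogonal map of \<open>real ^ 'd\<close>; acting by it on the affine span of \<open>L\<close> and by the identity on
  the orthogonal complement gives an isometry of the ambient space. Its conjugate by \<open>T\<close> is the
  required conformal map, since translations, linear similarities and the unit inversion are
  conformal in the charts and conformal maps compose.
\<close>

section \<open>Inversions and rescalings as bijections\<close>

lemma inversion_involution:
  assumes "\<rho> > 0"
  shows "inversion p \<rho> (inversion p \<rho> q) = q"
proof (cases p)
  case None
  then show ?thesis by (simp add: inversion_def)
next
  case (Some c)
  show ?thesis
  proof (cases q)
    case None
    then show ?thesis using Some by (simp add: inversion_def)
  next
    case q: (Some x)
    show ?thesis
    proof (cases "x = c")
      case True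
      then show ?thesis using Some q by (simp add: inversion_def)
    next
      case False
      \<comment> \<open>Seen from the centre, each of the two inversions only rescales
        \<open>w\<close>; the two scalars multiply to 1.\<close>
      define w where "w = x - c"
      have w: "norm w > 0" and x: "x = c + w" using False by (auto simp: w_def)
      have "\<rho>\<^sup>2 / (norm ((\<rho>\<^sup>2 / (norm w)\<^sup>2) *\<^sub>R w))\<^sup>2 * (\<rho>\<^sup>2 / (norm w)\<^sup>2) = 1"
        using assms w by (simp add: power_mult_distrib power_divide field_simps)
      then show ?thesis
        using Some q False assms w by (simp add: inversion_def x)
    qed
  qed
qed

lemma bij_inversion: "\<rho> > 0 \<Longrightarrow> bij (inversion p \<rho>)"
  by (rule o_bij[where g = "inversion p \<rho>"]) (auto simp: inversion_involution)

lemma bij_map_option: "bij f \<Longrightarrow> bij (map_option f)"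
  by (rule o_bij[where g = "map_option (inv f)"])
     (auto simp: fun_eq_iff option.map_comp o_def bij_is_inj bij_is_surj surj_f_inv_f option.map_ident)

lemma bij_scaleR: "t \<noteq> 0 \<Longrightarrow> bij (\<lambda>x::'a::real_vector. t *\<^sub>R x)"
  by (rule o_bij[where g = "\<lambda>x. (1 / t) *\<^sub>R x"]) (auto simp: fun_eq_iff)

lemma bij_rescaling: "t > 0 \<Longrightarrow> bij (rescaling t)"
  unfolding rescaling_def by (intro bij_map_option bij_scaleR) simp

section \<open>Conformal maps of the compactified space\<close>

lemma chart_chart [simp]: "chart p (chart p q) = q"
  by (simp add: chart_def inversion_involution)

text \<open>Each chart sends its own base point to a finite point (infinity goes to the origin), so
  \<open>the\<close> loses nothing there.\<close>

lemma Some_the_chart [simp]: "Some (the (chart p p)) = chart p p"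
  by (cases p) (auto simp: chart_def inversion_def)

lemma inj_chart: "inj (chart p)"
  by (metis chart_chart injI)

text \<open>Chain rule in charts, with the chart at \<open>h p\<close> inserted in between. The
  delicate point is that \<open>the\<close> loses information wherever the inner representative
  takes the value \<open>None\<close>.\<close>

lemma conformal_map_compose:
  assumes g: "conformal_map g" and h: "conformal_map h"
  shows "conformal_map (g \<circ> h)"
  unfolding conformal_map_def
proof (intro conjI allI)
  show "bij (g \<circ> h)"
    using g h by (auto simp: conformal_map_def intro: bij_comp)
  fix p :: "'a option"
  define q where "q = h p"
  define H where "H = (\<lambda>x. the (chart q (h (chart p (Some x)))))"
  define G where "G = (\<lambda>x. the (chart (g q) (g (chart q (Some x)))))"
  obtain D k where D: "k > 0" "(H has_derivative D) (at (the (chart p p)))"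
      "\<And>u v. D u \<bullet> D v = k * (u \<bullet> v)"
    using h unfolding conformal_map_def H_def q_def by blast
  obtain E l where E: "l > 0" "(G has_derivative E) (at (the (chart q q)))"
      "\<And>u v. E u \<bullet> E v = l * (u \<bullet> v)"
    using g unfolding conformal_map_def G_def by blast
  have Hp: "H (the (chart p p)) = the (chart q q)"
    by (simp add: H_def q_def)
  \<comment> \<open>\<open>B\<close> collects the points where \<open>H\<close> reads the default
    \<open>the None\<close>. By injectivity there is at most one, and it is not the base point, so
    the two representatives of the composition agree near the base point.\<close>
  define B where "B = (\<lambda>x. chart q (h (chart p (Some x)))) -` {None}"
  have "inj (\<lambda>x. chart q (h (chart p (Some x))))"
    using h inj_chart unfolding conformal_map_def inj_def bij_def by blast
  then have "finite B"
    unfolding B_def by (intro finite_vimageI) auto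
  moreover have "the (chart p p) \<notin> B"
    by (auto simp: B_def q_def) (metis Some_the_chart option.distinct(1))
  ultimately have ev: "eventually (\<lambda>x. x \<notin> B) (at (the (chart p p)))"
    by (intro eventually_at_topological[THEN iffD2] exI[of _ "- B"])
       (auto simp: finite_imp_closed)
  have eq: "G (H x) = the (chart ((g \<circ> h) p) ((g \<circ> h) (chart p (Some x))))" if "x \<notin> B" for x
  proof -
    from that obtain y where "chart q (h (chart p (Some x))) = Some y"
      by (auto simp: B_def)
    moreover from this have "chart q (Some y) = h (chart p (Some x))"
      by (metis chart_chart)
    ultimately show ?thesis by (simp add: G_def H_def q_def)
  qed
  have "((\<lambda>x. G (H x)) has_derivative (\<lambda>x. E (D x))) (at (the (chart p p)))"
    by (rule has_derivative_compose[OF D(2)]) (simp add: Hp E(2))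
  then have "((\<lambda>x. the (chart ((g \<circ> h) p) ((g \<circ> h) (chart p (Some x))))) has_derivative
        (\<lambda>x. E (D x))) (at (the (chart p p)))"
    by (rule has_derivative_transform_eventually)
       (use ev \<open>the (chart p p) \<notin> B\<close> eq in \<open>auto elim: eventually_mono\<close>)
  then show "\<exists>D k. k > 0 \<and>
      ((\<lambda>x. the (chart ((g \<circ> h) p) ((g \<circ> h) (chart p (Some x))))) has_derivative D)
        (at (the (chart p p))) \<and> (\<forall>u v. D u \<bullet> D v = k * (u \<bullet> v))"
    using D E by (intro exI[of _ "\<lambda>x. E (D x)"] exI[of _ "l * k"]) auto
qed

lemma conformal_map_linear:
  fixes f :: "'a::euclidean_space \<Rightarrow> 'a"
  assumes lin: "linear f" and k: "k > 0" and f: "\<And>u v. f u \<bullet> f v = k * (u \<bullet> v)"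
  shows "conformal_map (map_option f)"
  unfolding conformal_map_def
proof (intro conjI allI)
  have "inj f"
    using f k lin
    by (auto simp: linear_injective_0)
       (metis inner_eq_zero_iff inner_zero_left mult_eq_0_iff order_less_irrefl)
  then have "bij f" 
    using lin by (simp add: bij_def linear_injective_imp_surjective)
  then show "bij (map_option f)" by (rule bij_map_option)
  have bl: "bounded_linear f" using lin by (simp add: linear_linear)
  have f0: "f x = 0 \<longleftrightarrow> x = 0" for x
    using \<open>inj f\<close> lin by (metis injD linear_0)
  have nf: "(norm (f x))\<^sup>2 = k * (norm x)\<^sup>2" for x
    by (simp add: power2_norm_eq_inner f)
  fix p :: "'a option"
  show "\<exists>D k. k > 0 \<and>
      ((\<lambda>x. the (chart (map_option f p) (map_option f (chart p (Some x))))) has_derivative D)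
        (at (the (chart p p))) \<and> (\<forall>u v. D u \<bullet> D v = k * (u \<bullet> v))"
  proof (cases p)
    case (Some y)
    then show ?thesis
      using k f bounded_linear_imp_has_derivative[OF bl]
      by (intro exI[of _ f] exI[of _ k]) (auto simp: chart_def)
  next
    case None
    \<comment> \<open>In the chart at infinity x / |x|^2 is sent to f x / |x|^2, whose squared norm
      is k / |x|^2. Inverting back leaves f x / k, which is again linear.\<close>
    have "the (chart (map_option f p) (map_option f (chart p (Some x)))) = (1 / k) *\<^sub>R f x" for x
      using None k lin nf[of x]
      by (auto simp: chart_def inversion_def f0 linear_0 linear_cmul power_mult_distrib power_divide field_simps)
    then show ?thesis
      using k f bounded_linear_imp_has_derivative[OF bl]
      by (intro exI[of _ "\<lambda>x. (1 / k) *\<^sub>R f x"] exI[of _ "1 / k"])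
         (auto simp: power2_eq_square intro!: has_derivative_scaleR_right)
  qed
qed

lemma conformal_map_rescaling: "t > 0 \<Longrightarrow> conformal_map (rescaling t)"
  unfolding rescaling_def
  by (rule conformal_map_linear[where k = "t\<^sup>2"]) (auto simp: power2_eq_square)

lemma conformal_map_orthogonal:
  "orthogonal_transformation f \<Longrightarrow> conformal_map (map_option f)"
  by (rule conformal_map_linear[where k = 1]) (auto simp: orthogonal_transformation_def)

text \<open>In the chart at infinity the translation by \<open>b\<close> becomes
  \<open>x \<mapsto> (x + \<bar>x\<bar>\<^sup>2 b) / (1 + 2 b \<bullet> x + \<bar>b\<bar>\<^sup>2 \<bar>x\<bar>\<^sup>2)\<close>.\<close>

lemma conformal_map_translation:
  fixes b :: "'a::euclidean_space"
  shows "conformal_map (map_option (\<lambda>x. x + b))"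
  unfolding conformal_map_def
proof (intro conjI allI)
  have "bij (\<lambda>x. x + b)"
    by (rule o_bij[where g = "\<lambda>x. x - b"]) auto
  then show "bij (map_option (\<lambda>x. x + b))" by (rule bij_map_option)
  fix p :: "'a option"
  show "\<exists>D k. k > 0 \<and>
      ((\<lambda>x. the (chart (map_option (\<lambda>x. x + b) p) (map_option (\<lambda>x. x + b) (chart p (Some x)))))
        has_derivative D) (at (the (chart p p))) \<and> (\<forall>u v. D u \<bullet> D v = k * (u \<bullet> v))"
  proof (cases p)
    case (Some y)
    have "((\<lambda>x. x + b) has_derivative (\<lambda>x. x)) (at y)"
      by (auto intro!: derivative_eq_intros)
    with Some show ?thesis
      by (intro exI[of _ "\<lambda>x. x"] exI[of _ 1]) (auto simp: chart_def)
  next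
    case None
    \<comment> \<open>For nonzero x this is |x|^2 times |x / |x|^2 + b|^2. It vanishes only where
      the translated point is the origin, which the outer inversion sends to infinity; at x = 0 it
      is 1.\<close>
    define den where "den = (\<lambda>x. 1 + 2 * (b \<bullet> x) + (b \<bullet> b) * (x \<bullet> x))"
    define F where "F = (\<lambda>x. (1 / den x) *\<^sub>R (x + (x \<bullet> x) *\<^sub>R b))"
    have eq: "F x = the (chart (map_option (\<lambda>x. x + b) p) (map_option (\<lambda>x. x + b) (chart p (Some x))))"
      if "den x \<noteq> 0" for x
    proof (cases "x = 0")
      case True
      then show ?thesis using None by (simp add: F_def chart_def inversion_def)
    next
      case False
      define w where "w = (1 / (x \<bullet> x)) *\<^sub>R x + b"
      have xx: "x \<bullet> x > 0" using False by simp
      have ww: "w \<bullet> w = den x / (x \<bullet> x)"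
        using xx by (simp add: w_def den_def inner_simps inner_commute field_simps)
      have w0: "w \<noteq> 0" using ww that xx by auto
      have "(x \<bullet> x) *\<^sub>R w = x + (x \<bullet> x) *\<^sub>R b"
        using xx by (simp add: w_def scaleR_add_right)
      then have "F x = (1 / den x) *\<^sub>R (x \<bullet> x) *\<^sub>R w"
        by (simp add: F_def)
      also have "\<dots> = (1 / (w \<bullet> w)) *\<^sub>R w"
        by (simp add: ww)
      finally show ?thesis
        using None False w0 by (simp add: chart_def inversion_def power2_norm_eq_inner w_def)
    qed
    have "den 0 \<noteq> 0" by (simp add: den_def)
    have "open {x. den x \<noteq> 0}"
      unfolding den_def by (intro open_Collect_neq continuous_intros)
    then have ev: "eventually (\<lambda>x. den x \<noteq> 0) (at 0)"
      using \<open>den 0 \<noteq> 0\<close> by (auto simp: eventually_at_topological)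
    have "(den has_derivative (\<lambda>u. 2 * (b \<bullet> u))) (at 0)"
      unfolding den_def by (auto intro!: derivative_eq_intros)
    \<comment> \<open>The numerator of \<open>F\<close> vanishes at 0, so the derivative of
      \<open>den\<close> drops out, and the quadratic term has derivative 0.\<close>
    then have "(F has_derivative (\<lambda>x. x)) (at 0)"
      unfolding F_def using \<open>den 0 \<noteq> 0\<close>
      by (auto intro!: derivative_eq_intros simp: den_def)
    then have "((\<lambda>x. the (chart (map_option (\<lambda>x. x + b) p)
        (map_option (\<lambda>x. x + b) (chart p (Some x))))) has_derivative (\<lambda>x. x)) (at 0)"
      by (rule has_derivative_transform_eventually)
         (use ev \<open>den 0 \<noteq> 0\<close> eq in \<open>auto elim: eventually_mono\<close>)
    moreover have "the (chart p p) = 0" using None by (simp add: chart_def inversion_def)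
    ultimately show ?thesis
      by (intro exI[of _ "\<lambda>x. x"] exI[of _ 1]) auto
  qed
qed

text \<open>Over the origin and infinity exactly one of the two charts is the inversion itself,
  which cancels it to the identity. At every other point the derivative is a scaled
  reflection.\<close>

lemma conformal_map_unit_inversion:
  "conformal_map (inversion (Some (0::'a::euclidean_space)) 1)"
  unfolding conformal_map_def
proof (intro conjI allI)
  let ?J = "inversion (Some (0::'a)) 1"
  show "bij ?J" by (simp add: bij_inversion)
  fix p :: "'a option"
  show "\<exists>D k. k > 0 \<and> ((\<lambda>x. the (chart (?J p) (?J (chart p (Some x))))) has_derivative D)
      (at (the (chart p p))) \<and> (\<forall>u v. D u \<bullet> D v = k * (u \<bullet> v))"
  proof (cases "p = None \<or> p = Some 0")
    case True
    moreover have "?J None = Some 0" "?J (Some 0) = None"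
      by (simp_all add: inversion_def)
    ultimately have "(\<lambda>x. the (chart (?J p) (?J (chart p (Some x))))) = (\<lambda>x. x)"
      by (auto simp: chart_def inversion_involution)
    then show ?thesis
      by (intro exI[of _ "\<lambda>x. x"] exI[of _ 1]) auto
  next
    case False
    then obtain y where y: "p = Some y" "y \<noteq> 0" by (cases p) auto
    have yy: "y \<bullet> y > 0" using y by simp
    define F where "F = (\<lambda>x::'a. (1 / (x \<bullet> x)) *\<^sub>R x)"
    \<comment> \<open>The reflection in the hyperplane orthogonal to \<open>y\<close>, divided by
      |y|^2.\<close>
    define D where "D = (\<lambda>u. (1 / (y \<bullet> y)) *\<^sub>R u - (2 * (y \<bullet> u) / (y \<bullet> y)\<^sup>2) *\<^sub>R y)"
    have "(F has_derivative D) (at y)"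
      unfolding F_def D_def using yy
      by (auto intro!: derivative_eq_intros simp: fun_eq_iff power2_eq_square inner_commute field_simps)
    moreover have "eventually (\<lambda>x. F x = the (chart (?J p) (?J (chart p (Some x))))) (at y)"
      unfolding eventually_at_topological
      by (rule exI[of _ "- {0}"]) (use y in \<open>auto simp: F_def chart_def inversion_def power2_norm_eq_inner\<close>)
    ultimately have "((\<lambda>x. the (chart (?J p) (?J (chart p (Some x))))) has_derivative D) (at y)"
      by (rule has_derivative_transform_eventually)
         (use y in \<open>auto simp: F_def chart_def inversion_def power2_norm_eq_inner\<close>)
    moreover have "D u \<bullet> D v = (1 / (y \<bullet> y)\<^sup>2) * (u \<bullet> v)" for u v
      using yy by (simp add: D_def inner_simps inner_commute power2_eq_square field_simps)
    ultimately show ?thesis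
      using y yy by (intro exI[of _ D] exI[of _ "1 / (y \<bullet> y)\<^sup>2"]) (auto simp: chart_def)
  qed
qed

lemma conformal_map_inversion:
  fixes p :: "'a::euclidean_space option"
  assumes "\<rho> > 0"
  shows "conformal_map (inversion p \<rho>)"
proof (cases p)
  case None
  then have "inversion p \<rho> = map_option (\<lambda>x. x)"
    by (auto simp: inversion_def option.map_ident)
  then show ?thesis
    using conformal_map_orthogonal[OF orthogonal_transformation_id] by simp
next
  case (Some c)
  \<comment> \<open>A translation moves the centre to the origin; the radius then enters only as a
    stretch by \<open>\<rho>\<^sup>2\<close> after the unit inversion.\<close>
  have "inversion p \<rho> = map_option (\<lambda>x. x + c) \<circ> rescaling (\<rho>\<^sup>2) \<circ> inversion (Some 0) 1
      \<circ> map_option (\<lambda>x. x + - c)"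
    using Some by (auto simp: fun_eq_iff inversion_def rescaling_def split: option.split)
  then show ?thesis
    using assms by (simp only: conformal_map_compose conformal_map_translation conformal_map_rescaling
        conformal_map_unit_inversion zero_less_power)
qed

section \<open>Images of spheres\<close>

text \<open>If the centres differed, the far end points on the line of centres would give r = s + |d
  - c| and s = r + |d - c|. This makes centre and radius of a \<open>proper_sphere\<close> well
  defined, which \<open>Phi\<close> relies on.\<close>

lemma sphere_eq_sphere_imp:
  fixes c d :: "'a::euclidean_space"
  assumes "sphere c r = sphere d s" "r > 0" "s > 0"
  shows "c = d \<and> r = s"
proof -
  have cd: "c = d"
  proof (rule ccontr)
    assume "c \<noteq> d"
    define u where "u = sgn (d - c)"
    have u: "norm u = 1" "d - c = norm (d - c) *\<^sub>R u"
      using \<open>c \<noteq> d\<close> by (auto simp: u_def sgn_div_norm)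
    have n: "norm (d - c) > 0" using \<open>c \<noteq> d\<close> by simp
    have "d + s *\<^sub>R u \<in> sphere c r" unfolding assms(1) using u(1) assms(2,3) by (simp add: dist_norm)
    moreover have "c - r *\<^sub>R u \<in> sphere d s"
      unfolding assms(1)[symmetric] using u(1) assms(2,3) by (simp add: dist_norm)
    moreover have "(d + s *\<^sub>R u) - c = (norm (d - c) + s) *\<^sub>R u"
      using u(2) by (simp add: algebra_simps)
    moreover have "d - (c - r *\<^sub>R u) = (norm (d - c) + r) *\<^sub>R u"
      using u(2) by (simp add: algebra_simps)
    ultimately have "norm ((norm (d - c) + s) *\<^sub>R u) = r" "norm ((norm (d - c) + r) *\<^sub>R u) = s"
      by (metis dist_commute dist_norm mem_sphere)+
    then have "norm (d - c) + s = r" "norm (d - c) + r = s"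
      using n assms(2,3) u(1) by simp_all
    then show False using n by simp
  qed
  obtain e :: 'a where "norm e = 1" by (metis vector_choose_size zero_le_one)
  then have "c + r *\<^sub>R e \<in> sphere d s"
    using assms by (auto simp: assms(1)[symmetric] dist_norm)
  with cd \<open>norm e = 1\<close> assms show ?thesis by (simp add: dist_norm)
qed

lemma proper_sphere_eq_iff:
  assumes "r > 0" "s > 0"
  shows "proper_sphere c r = proper_sphere d s \<longleftrightarrow> c = d \<and> r = s"
  using assms sphere_eq_sphere_imp[of c r d s]
  by (auto simp: proper_sphere_def inj_image_eq_iff)

text \<open>A sphere contains a pair of antipodal points. Hence a tangent partner inside an
  arrangement is always a different sphere.\<close>

lemma not_tangent_self: "r > 0 \<Longrightarrow> \<not> tangent (proper_sphere c r) (proper_sphere c r)"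
proof
  assume r: "r > 0" and "tangent (proper_sphere c r) (proper_sphere c r)"
  then obtain p where p: "Some ` sphere c r = {p}"
    by (auto simp: tangent_def proper_sphere_def)
  obtain e :: 'a where e: "norm e = 1" by (metis vector_choose_size zero_le_one)
  have "Some (c + r *\<^sub>R e) \<in> Some ` sphere c r" "Some (c - r *\<^sub>R e) \<in> Some ` sphere c r"
    using r e by (auto simp: dist_norm)
  then have "c + r *\<^sub>R e = c - r *\<^sub>R e" unfolding p by auto
  then have "(2 * r) *\<^sub>R e = 0" by (simp add: algebra_simps flip: scaleR_2)
  with r e show False by auto
qed

text \<open>Inversion is an involution, so substituting it into the equation of the sphere gives the
  equation of the image, which is linear or quadratic according to whether \<open>k\<close>
  vanishes.\<close>

lemma is_sphere_inversion:
  fixes y :: "'a::euclidean_space"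
  assumes \<rho>: "\<rho> > 0" and r: "r > 0"
  shows "is_sphere (inversion p \<rho> ` proper_sphere y r)"
proof (cases p)
  case None
  then have "inversion p \<rho> ` proper_sphere y r = proper_sphere y r"
    by (auto simp: inversion_def)
  then show ?thesis using r by (auto simp: is_sphere_def)
next
  case (Some c)
  define a where "a = y - c"
  \<comment> \<open>The power of the centre of inversion with respect to the sphere; it is 0 exactly
    when the sphere passes through that centre.\<close>
  define k where "k = a \<bullet> a - r\<^sup>2"
  let ?I = "inversion p \<rho> ` proper_sphere y r"
  have mem: "q \<in> ?I \<longleftrightarrow> inversion p \<rho> q \<in> proper_sphere y r" for q
    by (auto simp: \<rho> inversion_involution intro!: image_eqI[where x = "inversion p \<rho> q"])
  have sphere_iff: "x \<in> sphere d s \<longleftrightarrow> (x - d) \<bullet> (x - d) = s\<^sup>2" if "s \<ge> 0" for x d :: 'a and s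
    using that by (auto simp: dist_norm norm_minus_commute power2_norm_eq_inner[symmetric])
  have None_iff: "None \<in> ?I \<longleftrightarrow> k = 0"
    unfolding mem using Some r by (auto simp: inversion_def proper_sphere_def k_def a_def sphere_iff
        inner_diff inner_commute simp del: mem_sphere)
  \<comment> \<open>The centre is the image of infinity, which lies on no proper sphere.\<close>
  have c_notin: "Some c \<notin> ?I"
    unfolding mem using Some by (auto simp: inversion_def proper_sphere_def)
  have Some_iff: "Some (c + w) \<in> ?I \<longleftrightarrow> \<rho>^4 - 2 * \<rho>\<^sup>2 * (w \<bullet> a) + k * (w \<bullet> w) = 0" if "w \<noteq> 0" for w
  proof -
    have ww: "w \<bullet> w > 0" using that by simp
    have "Some (c + w) \<in> ?I \<longleftrightarrow> ((\<rho>\<^sup>2 / (w \<bullet> w)) *\<^sub>R w - a) \<bullet> ((\<rho>\<^sup>2 / (w \<bullet> w)) *\<^sub>R w - a) = r\<^sup>2"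
      unfolding mem using Some that r by (auto simp: inversion_def proper_sphere_def a_def sphere_iff
        power2_norm_eq_inner algebra_simps simp del: mem_sphere)
    also have "((\<rho>\<^sup>2 / (w \<bullet> w)) *\<^sub>R w - a) \<bullet> ((\<rho>\<^sup>2 / (w \<bullet> w)) *\<^sub>R w - a) =
        (\<rho>^4 - 2 * \<rho>\<^sup>2 * (w \<bullet> a) + (a \<bullet> a) * (w \<bullet> w)) / (w \<bullet> w)"
      using ww by (simp add: inner_diff inner_commute field_simps power2_eq_square power4_eq_xxxx)
    also have "\<dots> = r\<^sup>2 \<longleftrightarrow> \<rho>^4 - 2 * \<rho>\<^sup>2 * (w \<bullet> a) + k * (w \<bullet> w) = 0"
      using ww by (auto simp: k_def field_simps)
    finally show ?thesis .
  qed
  show ?thesis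
  proof (cases "k = 0")
    case True
    have "a \<noteq> 0" using True r by (auto simp: k_def)
    \<comment> \<open>With k = 0 the equation loses its quadratic term and, divided by
      \<open>2 * \<rho>\<^sup>2\<close>, is that of a plane missing the centre of inversion.\<close>
    have "?I = plane a (a \<bullet> c + \<rho>\<^sup>2 / 2)"
    proof (rule set_eqI)
      fix q
      show "q \<in> ?I \<longleftrightarrow> q \<in> plane a (a \<bullet> c + \<rho>\<^sup>2 / 2)"
      proof (cases q)
        case None
        then show ?thesis using None_iff True by (simp add: plane_def)
      next
        case (Some x)
        show ?thesis
        proof (cases "x = c")
          case True
          then show ?thesis using c_notin Some \<rho> by (auto simp: plane_def)
        next
          case False
          have "\<rho>^4 - 2 * \<rho>\<^sup>2 * ((x - c) \<bullet> a) = 2 * \<rho>\<^sup>2 * (\<rho>\<^sup>2 / 2 - (x - c) \<bullet> a)"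
            by (simp add: power2_eq_square power4_eq_xxxx algebra_simps)
          then have "q \<in> ?I \<longleftrightarrow> \<rho>\<^sup>2 / 2 - (x - c) \<bullet> a = 0"
            using Some_iff[of "x - c"] Some False \<open>k = 0\<close> \<rho> by simp
          also have "\<dots> \<longleftrightarrow> a \<bullet> x = a \<bullet> c + \<rho>\<^sup>2 / 2"
            unfolding inner_commute[of _ a] inner_diff_right by argo
          finally show ?thesis
            using Some by (simp add: plane_def image_iff)
        qed
      qed
    qed
    then show ?thesis using \<open>a \<noteq> 0\<close> by (auto simp: is_sphere_def)
  next
    case False
    \<comment> \<open>The image is the homothetic copy of the original sphere with centre
      \<open>c\<close> and ratio \<open>\<rho>\<^sup>2 / k\<close>, hence this centre and
      radius.\<close>
    define e where "e = (\<rho>\<^sup>2 / k) *\<^sub>R a"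
    define s where "s = \<rho>\<^sup>2 * r / \<bar>k\<bar>"
    have "s > 0" using \<rho> r False by (simp add: s_def)
    have "?I = proper_sphere (c + e) s"
    proof (rule set_eqI)
      fix q
      show "q \<in> ?I \<longleftrightarrow> q \<in> proper_sphere (c + e) s"
      proof (cases q)
        case None
        then show ?thesis using None_iff False by (auto simp: proper_sphere_def)
      next
        case (Some x)
        define w where "w = x - c"
        have x: "x = c + w" by (simp add: w_def)
        have key: "k * ((w - e) \<bullet> (w - e) - s\<^sup>2) = \<rho>^4 - 2 * \<rho>\<^sup>2 * (w \<bullet> a) + k * (w \<bullet> w)"
        proof -
          have "k * (e \<bullet> e - s\<^sup>2) = \<rho>^4"
          proof -
            have "e \<bullet> e - s\<^sup>2 = \<rho>^4 / k\<^sup>2 * (a \<bullet> a - r\<^sup>2)"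
              using False by (simp add: e_def s_def power_divide power_mult_distrib field_simps
                  power2_eq_square power4_eq_xxxx)
            then show ?thesis using False by (simp add: k_def[symmetric]) (simp add: power2_eq_square)
          qed
          moreover have "k * (w \<bullet> e) = \<rho>\<^sup>2 * (w \<bullet> a)" using False by (simp add: e_def)
          ultimately show ?thesis by (simp add: inner_diff inner_commute algebra_simps)
        qed
        have "q \<in> proper_sphere (c + e) s \<longleftrightarrow> (w - e) \<bullet> (w - e) = s\<^sup>2"
          using Some \<open>s > 0\<close> by (auto simp: proper_sphere_def sphere_iff x simp del: mem_sphere)
        also have "\<dots> \<longleftrightarrow> \<rho>^4 - 2 * \<rho>\<^sup>2 * (w \<bullet> a) + k * (w \<bullet> w) = 0"
          using key False by (metis diff_eq_eq diff_self mult_eq_0_iff eq_iff_diff_eq_0)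
        also have "\<dots> \<longleftrightarrow> q \<in> ?I"
          \<comment> \<open>For w = 0 both sides fail: the equation would read
            \<open>\<rho>^4 = 0\<close>.\<close>
          using Some_iff[of w] Some x c_notin \<rho> by (cases "w = 0") auto
        finally show ?thesis by blast
      qed
    qed
    then show ?thesis using \<open>s > 0\<close> by (auto simp: is_sphere_def)
  qed
qed

lemma rescaling_proper_sphere:
  assumes "t > 0"
  shows "rescaling t ` proper_sphere y r = proper_sphere (t *\<^sub>R y) (t * r)"
proof -
  have d: "dist (t *\<^sub>R a) (t *\<^sub>R b) = t * dist a b" for a b :: 'a
    using assms by (simp add: dist_norm flip: scaleR_diff_right)
  have "(*\<^sub>R) t ` sphere y r = sphere (t *\<^sub>R y) (t * r)"
  proof (intro equalityI subsetI)
    fix x assume "x \<in> sphere (t *\<^sub>R y) (t * r)"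
    then have "t * dist y ((1 / t) *\<^sub>R x) = t * r"
      using assms by (simp flip: d)
    then show "x \<in> (*\<^sub>R) t ` sphere y r"
      using assms by (intro image_eqI[of _ _ "(1 / t) *\<^sub>R x"]) auto
  qed (auto simp: d)
  then show ?thesis
    by (simp add: rescaling_def proper_sphere_def image_image)
       (metis (no_types, lifting) image_cong image_image)
qed

section \<open>Tangency\<close>

lemma tangent_image_iff: "inj f \<Longrightarrow> tangent (f ` C) (f ` D) \<longleftrightarrow> tangent C D"
proof
  assume f: "inj f" and "tangent (f ` C) (f ` D)"
  then obtain p where p: "f ` (C \<inter> D) = {p}" by (auto simp: tangent_def image_Int)
  then obtain q where "q \<in> C \<inter> D" "f q = p" by blast
  with p f have "C \<inter> D = {q}" by (auto dest: injD)
  then show "tangent C D" by (auto simp: tangent_def)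
next
  assume f: "inj f" and "tangent C D"
  then obtain p where "C \<inter> D = {p}" by (auto simp: tangent_def)
  with f have "f ` C \<inter> f ` D = {f p}" by (simp flip: image_Int)
  then show "tangent (f ` C) (f ` D)" by (auto simp: tangent_def)
qed

lemma non_intersecting_image_iff:
  "inj f \<Longrightarrow> non_intersecting (f ` C) (f ` D) \<longleftrightarrow> non_intersecting C D"
  by (auto simp: non_intersecting_def tangent_image_iff inj_image_eq_iff simp flip: image_Int)

text \<open>A negative \<open>s\<close> describes inner tangency.\<close>

lemma tangent_proper_spheres:
  fixes c d :: "'a::euclidean_space"
  assumes "r > 0" "s \<noteq> 0" "r + s > 0" and dist: "dist c d = r + s"
  shows "tangent (proper_sphere d \<bar>s\<bar>) (proper_sphere c r)"
proof -
  define v where "v = d - c"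
  \<comment> \<open>The vector from \<open>c\<close> to the touching point, which lies on the line
    of centres; for negative \<open>s\<close> it lies beyond \<open>d\<close>.\<close>
  define e where "e = (r / (r + s)) *\<^sub>R v"
  have v: "v \<bullet> v = (r + s)\<^sup>2"
    using dist by (simp add: v_def dist_norm norm_minus_commute flip: power2_norm_eq_inner)
  have nv: "norm v = r + s" using dist by (simp add: v_def dist_norm norm_minus_commute)
  have "x = c + e" if x: "dist c x = r" "dist d x = \<bar>s\<bar>" for x
  proof -
    define w where "w = x - c"
    have w: "w \<bullet> w = r\<^sup>2" "(w - v) \<bullet> (w - v) = s\<^sup>2"
      using x by (auto simp: w_def v_def dist_norm norm_minus_commute simp flip: power2_norm_eq_inner)
    then have "w \<bullet> v = r * (r + s)"
      using v by (simp add: inner_diff inner_commute power2_eq_square algebra_simps)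
    then have "(w - e) \<bullet> (w - e) = 0"
      using w(1) v assms(3) by (simp add: e_def inner_diff inner_commute power2_eq_square)
    then have "x - c = e" by (simp add: w_def)
    then show ?thesis by (metis add.commute diff_eq_eq)
  qed
  moreover have "dist c (c + e) = r"
    using assms(1,3) nv by (simp add: e_def dist_norm)
  moreover have "dist d (c + e) = \<bar>s\<bar>"
  proof -
    have "d - (c + e) = (1 - r / (r + s)) *\<^sub>R v"
      by (simp add: e_def v_def algebra_simps)
    also have "1 - r / (r + s) = s / (r + s)" using assms(3) by (simp add: field_simps)
    finally show ?thesis using nv assms(3) by (simp add: dist_norm)
  qed
  ultimately have iff: "dist c x = r \<and> dist d x = \<bar>s\<bar> \<longleftrightarrow> x = c + e" for x by blast
  have "proper_sphere d \<bar>s\<bar> \<inter> proper_sphere c r = Some ` {x. dist c x = r \<and> dist d x = \<bar>s\<bar>}"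
    by (auto simp: proper_sphere_def)
  also have "\<dots> = {Some (c + e)}" by (simp add: iff)
  finally have "proper_sphere d \<bar>s\<bar> \<inter> proper_sphere c r = {Some (c + e)}" .
  then show ?thesis by (auto simp: tangent_def)
qed

lemma tangent_sphere_plane:
  fixes x :: "'a::euclidean_space"
  assumes "norm a = 1" "\<bar>a \<bullet> x - b\<bar> = s"
  shows "tangent (proper_sphere x s) (plane a b)"
proof -
  \<comment> \<open>Signed distance from \<open>x\<close> to the plane, so that x + h a is the foot
    of the perpendicular.\<close>
  define h where "h = b - a \<bullet> x"
  have h: "\<bar>h\<bar> = s" using assms by (simp add: h_def)
  have aa: "a \<bullet> a = 1" using assms(1) by (simp add: norm_eq_1)
  have "y = x + h *\<^sub>R a" if y: "dist x y = s" "a \<bullet> y = b" for y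
  proof -
    define w where "w = y - x"
    have "norm w = \<bar>h\<bar>" using y h by (simp add: w_def dist_norm norm_minus_commute)
    then have "w \<bullet> w = h\<^sup>2" by (simp flip: power2_norm_eq_inner)
    moreover have "a \<bullet> w = h" using y by (simp add: w_def h_def inner_diff_right)
    ultimately have "(w - h *\<^sub>R a) \<bullet> (w - h *\<^sub>R a) = 0"
      using aa by (simp add: inner_diff inner_commute power2_eq_square)
    then have "y - x = h *\<^sub>R a" by (simp add: w_def)
    then show ?thesis by (metis add.commute diff_eq_eq)
  qed
  moreover have "dist x (x + h *\<^sub>R a) = s" using assms(1) h by (simp add: dist_norm)
  moreover have "a \<bullet> (x + h *\<^sub>R a) = b" using aa by (simp add: h_def inner_add_right)
  ultimately have iff: "dist x y = s \<and> a \<bullet> y = b \<longleftrightarrow> y = x + h *\<^sub>R a" for y by blast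
  have "proper_sphere x s \<inter> plane a b = Some ` {y. dist x y = s \<and> a \<bullet> y = b}"
    by (auto simp: proper_sphere_def plane_def)
  also have "\<dots> = {Some (x + h *\<^sub>R a)}" by (simp add: iff)
  finally have "proper_sphere x s \<inter> plane a b = {Some (x + h *\<^sub>R a)}" .
  then show ?thesis by (auto simp: tangent_def)
qed

lemma disjoint_proper_spheres:
  assumes "dist c d > r + s"
  shows "proper_sphere c r \<inter> proper_sphere d s = {}"
proof -
  have "dist d x \<noteq> s" if "dist c x = r" for x
    using assms dist_triangle[of c d x] that by (auto simp: dist_commute)
  then show ?thesis by (auto simp: proper_sphere_def)
qed

lemma tangent_unit_spheres_iff:
  assumes "dist c d \<ge> 2"
  shows "tangent (proper_sphere c 1) (proper_sphere d 1) \<longleftrightarrow> dist c d = 2"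
proof (cases "dist c d = 2")
  case True
  then show ?thesis using tangent_proper_spheres[of 1 1 d c] by (simp add: dist_commute)
next
  case False
  then show ?thesis using assms disjoint_proper_spheres[of 1 1 c d] by (simp add: tangent_def)
qed

lemma non_intersecting_unit_spheres:
  assumes "dist c d \<ge> 2"
  shows "non_intersecting (proper_sphere c 1) (proper_sphere d 1)"
  using assms disjoint_proper_spheres[of 1 1 c d] tangent_unit_spheres_iff[of c d]
  by (cases "dist c d = 2") (auto simp: non_intersecting_def proper_sphere_eq_iff)

section \<open>The normalising map\<close>

lemma tangent_Z: "x \<in> Z C \<Longrightarrow> tangent (proper_sphere x 1) C"
  using tangent_proper_spheres[where s = 1] by (auto simp: Z_def)

text \<open>The points b a and c a lie on the two planes, so the primed gap is the other one times
  the inner product of two unit vectors. Used in both directions, this shows that the gap fixed by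
  \<open>normalizing\<close> is the one of whichever representation \<open>Z0\<close> picks.\<close>

lemma parallel_planes_gap_le:
  assumes "norm a = 1" "norm a' = 1" "plane a b = plane a' b'" "plane a c = plane a' c'"
  shows "\<bar>b' - c'\<bar> \<le> \<bar>b - c\<bar>"
proof -
  have aa: "a \<bullet> a = 1" using assms(1) by (simp add: norm_eq_1)
  have "Some (b *\<^sub>R a) \<in> plane a b" "Some (c *\<^sub>R a) \<in> plane a c"
    using aa by (auto simp: plane_def)
  then have "b' - c' = (b - c) * (a' \<bullet> a)"
    unfolding assms(3,4) by (auto simp: plane_def algebra_simps)
  moreover have "\<bar>a' \<bullet> a\<bar> \<le> 1" using Cauchy_Schwarz_ineq2[of a' a] assms by simp
  ultimately show ?thesis by (simp add: abs_mult mult_left_le)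
qed

text \<open>The two images have gap 2, so a point of the middle locus is at distance exactly 1 from
  both.\<close>

lemma tangent_Z0:
  assumes T: "normalizing S1 S2 T" and x: "x \<in> Z0 (T ` S1) (T ` S2)"
  shows "tangent (proper_sphere x 1) (T ` S1) \<and> tangent (proper_sphere x 1) (T ` S2)"
proof -
  \<comment> \<open>Planes contain infinity and proper spheres do not, so only one disjunct of
    \<open>Z0\<close> can apply.\<close>
  have ne: "plane a b \<noteq> proper_sphere q r" for a :: 'a and b q r
    by (auto simp: plane_def proper_sphere_def)
  consider (planes) a b c where "norm a = 1" "\<bar>b - c\<bar> = 2" "T ` S1 = plane a b" "T ` S2 = plane a c"
    | (spheres) q r1 r2 where "r1 > 0" "r2 > 0" "\<bar>r1 - r2\<bar> = 2"
        "T ` S1 = proper_sphere q r1" "T ` S2 = proper_sphere q r2"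
    using T unfolding normalizing_def by (auto split: if_splits)
  then show ?thesis
  proof cases
    case planes
    obtain a' b' c' where *: "norm a' = 1" "T ` S1 = plane a' b'" "T ` S2 = plane a' c'"
        "a' \<bullet> x = (b' + c') / 2"
      using x planes(3) ne unfolding Z0_def by (smt (verit) mem_Collect_eq)
    then have "\<bar>b' - c'\<bar> = \<bar>b - c\<bar>"
      using planes by (intro antisym parallel_planes_gap_le) auto
    with *(4) planes(2) have "a' \<bullet> x - b' = (c' - b') / 2" "a' \<bullet> x - c' = (b' - c') / 2"
        "\<bar>c' - b'\<bar> = 2" "\<bar>b' - c'\<bar> = 2"
      by (auto simp: field_simps)
    then have "\<bar>a' \<bullet> x - b'\<bar> = 1" "\<bar>a' \<bullet> x - c'\<bar> = 1" by simp_all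
    with *(1) show ?thesis unfolding *(2,3) by (simp add: tangent_sphere_plane)
  next
    case spheres
    obtain q' r1' r2' where "r1' > 0" "r2' > 0" "T ` S1 = proper_sphere q' r1'"
        "T ` S2 = proper_sphere q' r2'" "dist q' x = (r1' + r2') / 2"
      using x spheres(4) ne unfolding Z0_def mem_sphere by (smt (verit) mem_Collect_eq)
    then have d: "dist q x = (r1 + r2) / 2"
      using spheres by (simp add: proper_sphere_eq_iff)
    \<comment> \<open>The unit sphere touches the smaller image from outside and the larger one from
      inside; the latter is the case s = -1 of \<open>tangent_proper_spheres\<close>.\<close>
    consider "r2 = r1 + 2" | "r1 = r2 + 2" using spheres(3) by linarith
    then show ?thesis
    proof cases
      case 1
      then show ?thesis
        using tangent_proper_spheres[of r1 1 q x] tangent_proper_spheres[of r2 "-1" q x] spheres d by simp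
    next
      case 2
      then show ?thesis
        using tangent_proper_spheres[of r2 1 q x] tangent_proper_spheres[of r1 "-1" q x] spheres d by simp
    qed
  qed
qed

lemma center_set_tangent:
  assumes "normalizing (S 1) (S 2) T" "center_set (\<lambda>i. T ` S i) m L" "x \<in> L" "i \<in> {1..m}"
  shows "tangent (proper_sphere x 1) (T ` S i)"
proof -
  consider "\<forall>i\<in>{1..m}. tangent (proper_sphere x 1) (T ` S i)"
    | "x \<in> Z0 (T ` S 1) (T ` S 2)" "\<forall>i\<in>{3..m}. x \<in> Z (T ` S i)"
    using assms(2,3) unfolding center_set_def by blast
  then show ?thesis
  proof cases
    case 1
    then show ?thesis using assms(4) by blast
  next
    case 2
    have "i = 1 \<or> i = 2 \<or> i \<in> {3..m}" using assms(4) by auto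
    then show ?thesis using 2 tangent_Z0[OF assms(1)] tangent_Z by blast
  qed
qed

text \<open>Since inversions are involutions, \<open>inv T\<close> is built from the same kinds of
  maps as \<open>T\<close>. Conformality and preservation of spheres thus carry over to it.\<close>

lemma normalizing_decomp:
  assumes "normalizing S1 S2 T"
  obtains p \<rho> t where "\<rho> > 0" "t > 0" "T = rescaling t \<circ> inversion p \<rho>"
    "inv T = inversion p \<rho> \<circ> rescaling (1 / t)"
proof -
  obtain p \<rho> t where *: "\<rho> > 0" "t > 0" "T = rescaling t \<circ> inversion p \<rho>"
    using assms unfolding normalizing_def by blast
  have r: "rescaling t (rescaling (1 / t) q) = q" for q :: "'a option"
    using \<open>t > 0\<close> by (cases q) (auto simp: rescaling_def)
  have "bij T" using * by (simp add: bij_comp bij_inversion bij_rescaling)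
  moreover have "T ((inversion p \<rho> \<circ> rescaling (1 / t)) q) = q" for q
    using * by (simp add: inversion_involution r)
  ultimately have "inv T = inversion p \<rho> \<circ> rescaling (1 / t)"
    by (metis (no_types, lifting) bij_is_inj ext inv_f_f)
  with * show thesis by (rule that)
qed

lemma normalizing_bij: "normalizing S1 S2 T \<Longrightarrow> bij T"
  by (elim normalizing_decomp) (simp add: bij_comp bij_inversion bij_rescaling)

lemma normalizing_conformal: "normalizing S1 S2 T \<Longrightarrow> conformal_map T"
  by (elim normalizing_decomp)
     (simp add: conformal_map_compose conformal_map_inversion conformal_map_rescaling)

lemma normalizing_inv_conformal: "normalizing S1 S2 T \<Longrightarrow> conformal_map (inv T)"
  by (elim normalizing_decomp)
     (simp add: conformal_map_compose conformal_map_inversion conformal_map_rescaling)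

lemma normalizing_is_sphere:
  assumes "normalizing S1 S2 T" "r > 0"
  shows "is_sphere (inv T ` proper_sphere y r)"
  using assms(1)
proof (rule normalizing_decomp)
  fix p \<rho> t
  assume "\<rho> > 0" "t > 0" "inv T = inversion p \<rho> \<circ> rescaling (1 / t)"
  then show ?thesis
    using \<open>r > 0\<close> by (simp only: image_comp[symmetric] rescaling_proper_sphere zero_less_divide_1_iff)
      (simp add: is_sphere_inversion)
qed

section \<open>Codes and arrangements\<close>

text \<open>Scaled by \<open>r\<close>, the distance of two code points is the distance of the
  corresponding centres, and touching unit spheres have centres at distance 2.\<close>

lemma code_angle_iff:
  fixes x y :: "'b::euclidean_space"
  assumes r: "r > 0" "code_angle r \<psi>" and x: "norm x = 1" and y: "norm y = 1"
  shows "angular_dist x y \<ge> \<psi> \<longleftrightarrow> r * dist x y \<ge> 2"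
    and "angular_dist x y = \<psi> \<longleftrightarrow> r * dist x y = 2"
proof -
  have xy: "\<bar>x \<bullet> y\<bar> \<le> 1" using Cauchy_Schwarz_ineq2[of x y] x y by simp
  have d: "(dist x y)\<^sup>2 = 2 - 2 * (x \<bullet> y)"
    using x y by (simp add: dist_norm power2_norm_eq_inner inner_diff inner_commute norm_eq_1)
  have "(angular_dist x y \<ge> \<psi> \<longleftrightarrow> r * dist x y \<ge> 2) \<and> (angular_dist x y = \<psi> \<longleftrightarrow> r * dist x y = 2)"
  proof (cases "r \<ge> 1")
    case True
    define q where "q = 1 - 2 / r\<^sup>2"
    have "2 / r\<^sup>2 \<le> 2" "2 / r\<^sup>2 \<ge> 0" using True by (auto simp: divide_le_eq)
    then have q: "\<bar>q\<bar> \<le> 1" unfolding q_def abs_le_iff by linarith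
    have \<psi>: "\<psi> = arccos q" using r True by (simp add: code_angle_def q_def)
    \<comment> \<open>Law of cosines with q = cos \<psi>: the sign of q minus the inner product
      decides both comparisons.\<close>
    have rd: "(r * dist x y)\<^sup>2 - 2\<^sup>2 = 2 * r\<^sup>2 * (q - x \<bullet> y)"
      using r(1) by (simp add: power_mult_distrib d q_def field_simps)
    have pos: "2 * r\<^sup>2 > 0" "r * dist x y \<ge> 0" using r(1) by auto
    have "angular_dist x y \<ge> \<psi> \<longleftrightarrow> q - x \<bullet> y \<ge> 0"
      using xy q by (simp add: \<psi> angular_dist_def arccos_le_mono)
    also have "\<dots> \<longleftrightarrow> (r * dist x y)\<^sup>2 - 2\<^sup>2 \<ge> 0"
      unfolding rd using pos(1) by (metis less_le_not_le mult_nonneg_nonneg zero_le_mult_iff)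
    also have "\<dots> \<longleftrightarrow> r * dist x y \<ge> 2"
      using pos(2) by (metis diff_ge_0_iff_ge abs_le_square_iff abs_of_nonneg abs_numeral)
    finally have 1: "angular_dist x y \<ge> \<psi> \<longleftrightarrow> r * dist x y \<ge> 2" .
    have "angular_dist x y = \<psi> \<longleftrightarrow> q - x \<bullet> y = 0"
      using xy q by (auto simp: \<psi> angular_dist_def arccos_eq_iff)
    also have "\<dots> \<longleftrightarrow> (r * dist x y)\<^sup>2 - 2\<^sup>2 = 0"
      unfolding rd using pos(1) by simp
    also have "\<dots> \<longleftrightarrow> r * dist x y = 2"
      using pos(2) by (metis diff_eq_diff_eq diff_self power2_eq_iff_nonneg zero_le_numeral)
    finally show ?thesis using 1 by blast
  next
    case False
    \<comment> \<open>For r < 1 all sides are false: no angle exceeds pi, and the centres are at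
      distance at most 2 r < 2. A code then has at most one point.\<close>
    have "arccos (x \<bullet> y) \<le> pi" using xy by (intro arccos_ubound) auto
    moreover have "dist x y \<le> 2" using x y norm_triangle_ineq4[of x y] by (simp add: dist_norm)
    then have "r * dist x y \<le> r * 2" using r(1) by (intro mult_left_mono) auto
    then have "r * dist x y < 2" using False by simp
    ultimately show ?thesis using False r(2) by (simp add: code_angle_def angular_dist_def)
  qed
  then show "angular_dist x y \<ge> \<psi> \<longleftrightarrow> r * dist x y \<ge> 2" "angular_dist x y = \<psi> \<longleftrightarrow> r * dist x y = 2"
    by auto
qed

section \<open>Isometries of codes and orthogonal maps\<close>

lemma spherical_code_orthogonal_image:
  "orthogonal_transformation f \<Longrightarrow> spherical_code \<psi> X \<Longrightarrow> spherical_code \<psi> (f ` X)"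
  by (auto simp: spherical_code_def angular_dist_def orthogonal_transformation_def norm_eq_1 image_subset_iff
      subset_iff)

text \<open>By \<open>isometry_sphere_extend\<close> an isometry of the unit sphere is the
  restriction of an orthogonal map, so isometries of codes may be taken linear.\<close>

lemma isometric_on_sphere_iff:
  fixes X :: "'b::euclidean_space set"
  assumes "X \<subseteq> sphere 0 1"
  shows "isometric_on_sphere X Y \<longleftrightarrow> (\<exists>f. orthogonal_transformation f \<and> f ` X = Y)"
proof
  assume "isometric_on_sphere X Y"
  then obtain g where g: "g ` sphere 0 1 = sphere 0 1" "g ` X = Y"
      "\<And>x y. x \<in> sphere 0 1 \<Longrightarrow> y \<in> sphere 0 1 \<Longrightarrow> dist (g x) (g y) = dist x y"
    unfolding isometric_on_sphere_def by blast
  obtain f where f: "orthogonal_transformation f" "\<And>x. norm x = 1 \<Longrightarrow> f x = g x"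
    using isometry_sphere_extend[of g] g(1,3) by (force simp: set_eq_iff image_iff)
  have "f ` X = g ` X" using f(2) assms by (intro image_cong) auto
  with f g show "\<exists>f. orthogonal_transformation f \<and> f ` X = Y" by auto
next
  assume "\<exists>f. orthogonal_transformation f \<and> f ` X = Y"
  then obtain f where f: "orthogonal_transformation f" "f ` X = Y" by blast
  have n: "norm (f x) = norm x" for x using f(1) by (rule orthogonal_transformation_norm)
  have "f ` sphere 0 1 = sphere 0 1"
  proof (intro equalityI subsetI)
    fix y :: 'b assume "y \<in> sphere 0 1"
    moreover obtain x where "y = f x" using orthogonal_transformation_surj[OF f(1)] by (meson surjD)
    ultimately show "y \<in> f ` sphere 0 1" by (simp add: n)
  qed (auto simp: n)
  moreover have "dist (f x) (f y) = dist x y" for x y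
    using f(1) by (simp add: dist_norm n orthogonal_transformation_linear flip: linear_diff)
  ultimately show "isometric_on_sphere X Y"
    using f(2) unfolding isometric_on_sphere_def by blast
qed

lemma orthogonal_transformation_extend:
  fixes \<iota> :: "'b::euclidean_space \<Rightarrow> 'a::euclidean_space"
  assumes \<iota>: "linear \<iota>" "\<And>x. norm (\<iota> x) = norm x" and f: "orthogonal_transformation f"
  obtains g where "orthogonal_transformation g" "\<And>x. g (\<iota> x) = \<iota> (f x)"
proof -
  have inn: "\<iota> x \<bullet> \<iota> y = x \<bullet> y" for x y
    using \<iota> by (simp add: dot_norm flip: linear_add)
  have lf: "linear f" using f by (rule orthogonal_transformation_linear)
  \<comment> \<open>Because \<iota> is isometric, its adjoint is a left inverse, and \<iota> after
    \<kappa> is the orthogonal projection onto the range of \<iota>.\<close>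
  define \<kappa> where "\<kappa> = adjoint \<iota>"
  have \<kappa>: "linear \<kappa>" "\<iota> x \<bullet> v = x \<bullet> \<kappa> v" for x v
    using \<iota>(1) by (simp_all add: \<kappa>_def adjoint_linear adjoint_works)
  have "y \<bullet> \<kappa> (\<iota> x) = y \<bullet> x" for x y by (simp add: inn flip: \<kappa>(2))
  then have \<kappa>\<iota>: "\<kappa> (\<iota> x) = x" for x by (metis vector_eq_ldot)
  \<comment> \<open>\<open>f\<close> on the range of \<iota>, the identity on its orthogonal
    complement.\<close>
  define g where "g = (\<lambda>v. \<iota> (f (\<kappa> v)) + (v - \<iota> (\<kappa> v)))"
  have "linear g"
    by (rule linearI)
       (simp_all add: g_def linear_add[OF \<iota>(1)] linear_add[OF lf] linear_add[OF \<kappa>(1)]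
         linear_cmul[OF \<iota>(1)] linear_cmul[OF lf] linear_cmul[OF \<kappa>(1)] algebra_simps)
  moreover have "g v \<bullet> g w = v \<bullet> w" for v w
  proof -
    have ff: "f x \<bullet> f y = x \<bullet> y" for x y using f by (simp add: orthogonal_transformation_def)
    have \<kappa>': "v \<bullet> \<iota> x = \<kappa> v \<bullet> x" for v x using \<kappa>(2)[of x v] by (simp add: inner_commute)
    show ?thesis
      by (simp add: g_def inner_add inner_diff inn ff \<kappa>(2) \<kappa>' \<kappa>\<iota>
          linear_add[OF \<kappa>(1)] linear_diff[OF \<kappa>(1)])
  qed
  ultimately have "orthogonal_transformation g" by (simp add: orthogonal_transformation_def)
  then show thesis by (rule that) (simp add: g_def \<kappa>\<iota>)
qed

section \<open>The dictionary between codes and arrangements\<close>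

lemma sphere_frame_point_dist:
  "sphere_frame L z r \<iota> \<Longrightarrow> dist (z + r *\<^sub>R \<iota> x) (z + r *\<^sub>R \<iota> y) = r * dist x y"
  by (simp add: sphere_frame_def dist_norm flip: scaleR_diff_right linear_diff)

lemma sphere_frame_point_in:
  "sphere_frame L z r \<iota> \<Longrightarrow> norm x = 1 \<Longrightarrow> z + r *\<^sub>R \<iota> x \<in> L"
  by (auto simp: sphere_frame_def)

lemma proj_sphere_frame_point:
  assumes "sphere_frame L z r \<iota>" "norm x = 1"
  shows "proj z \<iota> (z + r *\<^sub>R \<iota> x) = x"
proof -
  have "inj \<iota>"
    using assms(1) by (auto simp: sphere_frame_def linear_injective_0) (metis norm_eq_zero)
  moreover have "sgn (r *\<^sub>R \<iota> x) = \<iota> x"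
    using assms by (simp add: sphere_frame_def sgn_div_norm)
  ultimately show ?thesis by (simp add: proj_def)
qed

text \<open>On \<open>L\<close> the central projection is inverse to the parametrisation by the
  frame, so the arrangement can be indexed by the code itself.\<close>

lemma arrangement_of_code_eq:
  assumes "sphere_frame L z r \<iota>" "X \<subseteq> sphere 0 1"
  shows "arrangement_of_code T L z \<iota> X = (\<lambda>x. inv T ` proper_sphere (z + r *\<^sub>R \<iota> x) 1) ` X"
proof -
  have "{y \<in> L. proj z \<iota> y \<in> X} = (\<lambda>x. z + r *\<^sub>R \<iota> x) ` X"
  proof (intro equalityI subsetI)
    fix y assume y: "y \<in> {y \<in> L. proj z \<iota> y \<in> X}"
    then obtain x where x: "norm x = 1" "y = z + r *\<^sub>R \<iota> x"
      using assms(1) by (auto simp: sphere_frame_def)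
    then show "y \<in> (\<lambda>x. z + r *\<^sub>R \<iota> x) ` X"
      using y proj_sphere_frame_point[OF assms(1)] by auto
  next
    fix y assume "y \<in> (\<lambda>x. z + r *\<^sub>R \<iota> x) ` X"
    then show "y \<in> {y \<in> L. proj z \<iota> y \<in> X}"
      using assms(2) sphere_frame_point_in[OF assms(1)] proj_sphere_frame_point[OF assms(1)] by auto
  qed
  then show ?thesis by (simp add: arrangement_of_code_def image_image)
qed

lemma bij_image_inv: "bij T \<Longrightarrow> T ` inv T ` A = A" "bij T \<Longrightarrow> inv T ` T ` A = A"
  by (simp_all add: bij_is_surj bij_is_inj image_f_inv_f)

lemma Phi_arrangement_of_code:
  assumes "bij T" and fr: "sphere_frame L z r \<iota>" and X: "X \<subseteq> sphere 0 1"
  shows "Phi T z \<iota> (arrangement_of_code T L z \<iota> X) = X"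
proof -
  have "{y. \<exists>C\<in>arrangement_of_code T L z \<iota> X. \<exists>\<rho>>0. T ` C = proper_sphere y \<rho>} =
      (\<lambda>x. z + r *\<^sub>R \<iota> x) ` X"
    unfolding arrangement_of_code_eq[OF fr X]
    by (auto simp: bij_image_inv[OF \<open>bij T\<close>] proper_sphere_eq_iff)
       (metis zero_less_one)
  moreover have "(\<lambda>x. proj z \<iota> (z + r *\<^sub>R \<iota> x)) ` X = (\<lambda>x. x) ` X"
    using X by (intro image_cong) (auto simp: proj_sphere_frame_point[OF fr])
  ultimately show ?thesis by (simp add: Phi_def image_image)
qed

text \<open>Take for \<open>Y\<close> all unit vectors whose sphere belongs to \<open>N\<close>;
  congruence ensures that every member of \<open>N\<close> arises from one. Together with
  \<open>Phi_arrangement_of_code\<close> this makes the two constructions mutually inverse.\<close>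

lemma Phi_congruent_arrangement:
  assumes "bij T" and fr: "sphere_frame L z r \<iota>" and N: "congruent_arrangement T L N"
  shows "Phi T z \<iota> N \<subseteq> sphere 0 1" "arrangement_of_code T L z \<iota> (Phi T z \<iota> N) = N"
proof -
  define Y where "Y = {x \<in> sphere 0 1. inv T ` proper_sphere (z + r *\<^sub>R \<iota> x) 1 \<in> N}"
  have Y: "Y \<subseteq> sphere 0 1" by (auto simp: Y_def)
  have "N = arrangement_of_code T L z \<iota> Y"
  proof (intro equalityI subsetI)
    fix C assume "C \<in> N"
    then obtain y where y: "y \<in> L" "T ` C = proper_sphere y 1"
      using N by (auto simp: congruent_arrangement_def)
    then obtain x where x: "norm x = 1" "y = z + r *\<^sub>R \<iota> x"
      using fr by (auto simp: sphere_frame_def)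
    have "C = inv T ` proper_sphere y 1" using y(2) bij_image_inv(2)[OF \<open>bij T\<close>, of C] by simp
    moreover from this have "x \<in> Y" using x \<open>C \<in> N\<close> by (simp add: Y_def)
    ultimately show "C \<in> arrangement_of_code T L z \<iota> Y"
      unfolding arrangement_of_code_eq[OF fr Y] x(2) by blast
  next
    fix C assume "C \<in> arrangement_of_code T L z \<iota> Y"
    then show "C \<in> N" unfolding arrangement_of_code_eq[OF fr Y] by (auto simp: Y_def)
  qed
  moreover from this have "Phi T z \<iota> N = Y"
    using Phi_arrangement_of_code[OF \<open>bij T\<close> fr Y] by simp
  ultimately show "Phi T z \<iota> N \<subseteq> sphere 0 1" "arrangement_of_code T L z \<iota> (Phi T z \<iota> N) = N"
    using Y by auto
qed

lemma congruent_arrangement_of_code: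
  assumes "bij T" and fr: "sphere_frame L z r \<iota>" and X: "X \<subseteq> sphere 0 1"
  shows "congruent_arrangement T L (arrangement_of_code T L z \<iota> X)"
  using X sphere_frame_point_in[OF fr]
  by (fastforce simp: congruent_arrangement_def arrangement_of_code_eq[OF fr X] bij_image_inv[OF \<open>bij T\<close>])

lemma tangent_to_all_arrangement_of_code:
  assumes T: "normalizing (S 1) (S 2) T" and L: "center_set (\<lambda>i. T ` S i) m L"
    and fr: "sphere_frame L z r \<iota>" and X: "X \<subseteq> sphere 0 1"
  shows "tangent_to_all (family S m) (arrangement_of_code T L z \<iota> X)"
proof -
  have b: "bij T" using T by (rule normalizing_bij)
  have "tangent (inv T ` proper_sphere y 1) (S i)" if "y \<in> L" "i \<in> {1..m}" for y i
    using center_set_tangent[OF T L that] tangent_image_iff[OF bij_is_inj[OF b], of "inv T ` proper_sphere y 1"]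
    by (simp add: bij_image_inv[OF b])
  then show ?thesis
    using X sphere_frame_point_in[OF fr]
    by (auto simp: tangent_to_all_def family_def arrangement_of_code_eq[OF fr X])
qed

text \<open>Injectivity of \<open>inv T\<close> reduces both claims to unit spheres, whose relative
  position depends only on the distance of their centres, and \<open>code_angle_iff\<close>
  translates that distance into an angle.\<close>

lemma arrangement_of_spherical_code:
  assumes "bij T" and fr: "sphere_frame L z r \<iota>" and \<psi>: "code_angle r \<psi>" and X: "spherical_code \<psi> X"
  defines "C \<equiv> \<lambda>x. inv T ` proper_sphere (z + r *\<^sub>R \<iota> x) 1"
  shows "x \<in> X \<Longrightarrow> y \<in> X \<Longrightarrow> C x \<noteq> C y \<Longrightarrow> non_intersecting (C x) (C y)"
    and "x \<in> X \<Longrightarrow> y \<in> X \<Longrightarrow> tangent (C x) (C y) \<longleftrightarrow> x \<noteq> y \<and> angular_dist x y = \<psi>"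
proof -
  assume xy: "x \<in> X" "y \<in> X"
  have r: "r > 0" using fr by (simp add: sphere_frame_def)
  have n: "norm x = 1" "norm y = 1" using X xy by (auto simp: spherical_code_def)
  have inj: "inj (inv T)" using \<open>bij T\<close> by (simp add: bij_imp_bij_inv bij_is_inj)
  have d: "dist (z + r *\<^sub>R \<iota> x) (z + r *\<^sub>R \<iota> y) \<ge> 2" if "x \<noteq> y"
    unfolding sphere_frame_point_dist[OF fr]
    using X xy that code_angle_iff(1)[OF r \<psi> n] by (auto simp: spherical_code_def)
  then show "non_intersecting (C x) (C y)" if "C x \<noteq> C y"
    using that by (cases "x = y")
      (auto simp: C_def non_intersecting_image_iff[OF inj] non_intersecting_unit_spheres)
  show "tangent (C x) (C y) \<longleftrightarrow> x \<noteq> y \<and> angular_dist x y = \<psi>"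
  proof (cases "x = y")
    case True
    then show ?thesis by (simp add: C_def tangent_image_iff[OF inj] not_tangent_self)
  next
    case False
    then show ?thesis
      unfolding C_def tangent_image_iff[OF inj] tangent_unit_spheres_iff[OF d[OF False]]
        code_angle_iff(2)[OF r \<psi> n] sphere_frame_point_dist[OF fr] by simp
  qed
qed

text \<open>An orthogonal map of codes extends to an isometry of the ambient space fixing
  \<open>z\<close>, and conjugation by \<open>T\<close> carries it back to the original
  spheres.\<close>

lemma conformal_map_between_arrangements:
  assumes T: "normalizing S1 S2 T" and fr: "sphere_frame L z r \<iota>" and X: "X \<subseteq> sphere 0 1"
    and f: "orthogonal_transformation f"
  obtains g where "conformal_map g"
    "(\<lambda>C. g ` C) ` arrangement_of_code T L z \<iota> X = arrangement_of_code T L z \<iota> (f ` X)"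
proof -
  have fX: "f ` X \<subseteq> sphere 0 1"
    using X f by (auto simp: orthogonal_transformation_norm)
  obtain h where h: "orthogonal_transformation h" "\<And>x. h (\<iota> x) = \<iota> (f x)"
    using fr f orthogonal_transformation_extend[of \<iota> f] by (auto simp: sphere_frame_def)
  define G where "G = (\<lambda>x. h (x + - z) + z)"
  have "map_option G = map_option (\<lambda>x. x + z) \<circ> map_option h \<circ> map_option (\<lambda>x. x + - z)"
    by (auto simp: G_def fun_eq_iff option.map_comp o_def)
  then have G: "conformal_map (map_option G)"
    by (simp only: conformal_map_compose conformal_map_translation conformal_map_orthogonal[OF h(1)])
  have bij: "bij T" using T by (rule normalizing_bij)
  define g where "g = inv T \<circ> map_option G \<circ> T"
  have "conformal_map g"
    unfolding g_def
    by (rule conformal_map_compose[OF conformal_map_compose[OF normalizing_inv_conformal[OF T] G]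
          normalizing_conformal[OF T]])
  moreover have Gs: "map_option G ` proper_sphere (z + r *\<^sub>R \<iota> x) 1 = proper_sphere (z + r *\<^sub>R \<iota> (f x)) 1" for x
  proof -
    have hl: "linear h" using h(1) by (rule orthogonal_transformation_linear)
    have dG: "dist (G u) (G v) = dist u v" for u v
      using hl by (simp add: G_def dist_norm orthogonal_transformation_norm[OF h(1)] flip: linear_diff)
    have Gc: "G (z + r *\<^sub>R \<iota> x) = z + r *\<^sub>R \<iota> (f x)"
      using hl by (simp add: G_def h(2) linear_cmul)
    have "surj G"
    proof (rule surjI)
      show "G (inv h (y - z) + z) = y" for y
        using orthogonal_transformation_surj[OF h(1)] by (simp add: G_def surj_f_inv_f)
    qed
    then have "G ` sphere c s = sphere (G c) s" for c s
      by (auto simp: dG) (metis dG image_eqI mem_sphere surjD)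
    then have "Some ` G ` sphere (z + r *\<^sub>R \<iota> x) 1 = proper_sphere (z + r *\<^sub>R \<iota> (f x)) 1"
      by (simp add: Gc proper_sphere_def)
    then show ?thesis by (simp add: proper_sphere_def image_image)
  qed
  have "g ` inv T ` proper_sphere (z + r *\<^sub>R \<iota> x) 1 = inv T ` proper_sphere (z + r *\<^sub>R \<iota> (f x)) 1" for x
    unfolding g_def image_comp[symmetric] by (simp only: bij_image_inv[OF bij] Gs)
  then have "(\<lambda>C. g ` C) ` arrangement_of_code T L z \<iota> X = arrangement_of_code T L z \<iota> (f ` X)"
    unfolding arrangement_of_code_eq[OF fr X] arrangement_of_code_eq[OF fr fX] by (simp add: image_image)
  ultimately show thesis using that by blast
qed

text \<open>Tangency to the family and non-intersection hold for every code. The existence of a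
  tangent partner does not: it says that every code point has another one at angle exactly \<psi>,
  hence the equivalence.\<close>

lemma kissing_arrangement_of_spherical_code:
  fixes z :: "'a::euclidean_space" and X :: "'b::euclidean_space set"
  assumes T: "normalizing (S 1) (S 2) T" and L: "center_set (\<lambda>i. T ` S i) m L"
    and fr: "sphere_frame L z r \<iota>" and \<psi>: "code_angle r \<psi>" and X: "spherical_code \<psi> X"
  defines "R \<equiv> arrangement_of_code T L z \<iota> X"
  shows "\<forall>C\<in>R. is_sphere C" "tangent_to_all (family S m) R" "pairwise_non_intersecting R"
    and "kissing_arrangement (family S m) R \<longleftrightarrow> (\<forall>x\<in>X. \<exists>y\<in>X. y \<noteq> x \<and> angular_dist x y = \<psi>)"
proof -
  have b: "bij T" using T by (rule normalizing_bij)
  have Xs: "X \<subseteq> sphere 0 1" using X by (simp add: spherical_code_def)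
  note eq = R_def[unfolded arrangement_of_code_eq[OF fr Xs]]
  note code = arrangement_of_spherical_code[OF b fr \<psi> X]
  show 1: "\<forall>C\<in>R. is_sphere C"
    by (auto simp: eq normalizing_is_sphere[OF T])
  show 2: "tangent_to_all (family S m) R"
    unfolding R_def by (rule tangent_to_all_arrangement_of_code[OF T L fr Xs])
  show 3: "pairwise_non_intersecting R"
    unfolding pairwise_non_intersecting_def eq using code(1) by blast
  have "(\<forall>x\<in>X. \<exists>y\<in>X. tangent (inv T ` proper_sphere (z + r *\<^sub>R \<iota> x) 1)
        (inv T ` proper_sphere (z + r *\<^sub>R \<iota> y) 1)) \<longleftrightarrow> (\<forall>x\<in>X. \<exists>y\<in>X. y \<noteq> x \<and> angular_dist x y = \<psi>)"
    by (intro ball_cong bex_cong refl) (use code(2) in blast)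
  then have "(\<forall>C\<in>R. \<exists>D\<in>R. tangent C D) \<longleftrightarrow> (\<forall>x\<in>X. \<exists>y\<in>X. y \<noteq> x \<and> angular_dist x y = \<psi>)"
    by (simp add: eq)
  then show "kissing_arrangement (family S m) R \<longleftrightarrow> (\<forall>x\<in>X. \<exists>y\<in>X. y \<noteq> x \<and> angular_dist x y = \<psi>)"
    by (simp add: kissing_arrangement_def 1 2 3)
qed

section \<open>Rotated codes and the final statement\<close>

lemma orthogonal_matrix_transformation:
  "orthogonal_matrix A \<Longrightarrow> orthogonal_transformation ((*v) A)" for A :: "real ^ 'n ^ 'n"
  by (simp add: orthogonal_transformation_matrix)

theorem theorem2p5:
  fixes S :: "nat \<Rightarrow> (real ^ 'n) option set" and m :: nat
    and T :: "(real ^ 'n) option \<Rightarrow> (real ^ 'n) option"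
    and L :: "(real ^ 'n) set" and z :: "real ^ 'n" and r \<psi> :: real
    and \<iota> :: "real ^ 'd \<Rightarrow> real ^ 'n"
  defines "P \<equiv> rotated_arrangement T L z \<iota>"
  assumes "2 \<le> m" and "m < CARD('n) + 2" and "CARD('d) = CARD('n) + 2 - m"
    and "S_family S m"
    and "normalizing (S 1) (S 2) T"
    and "center_set (\<lambda>i. T ` S i) m L"
    and "sphere_frame L z r \<iota>"
    and "code_angle r \<psi>"
  shows
    "(\<forall>X. spherical_code \<psi> X \<longrightarrow>
        (\<forall>A. rotation_matrix A \<longrightarrow>
           (\<forall>C\<in>P X A. is_sphere C) \<and>
           tangent_to_all (family S m) (P X A) \<and>
           pairwise_non_intersecting (P X A) \<and>
           (kissing_arrangement (family S m) (P X A) \<longleftrightarrow>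
              (\<forall>x\<in>X. \<exists>y\<in>X. y \<noteq> x \<and> angular_dist x y = \<psi>)) \<and>
           congruent_arrangement T L (P X A) \<and>
           Phi T z \<iota> (P X A) = (*v) A ` X) \<and>
        (\<forall>A B. rotation_matrix A \<longrightarrow> rotation_matrix B \<longrightarrow>
           equivalent_arrangements T z \<iota> (P X A) (P X B) \<and>
           (P X A = P X B \<longleftrightarrow> (*v) A ` X = (*v) B ` X)) \<and>
        (\<forall>N. kissing_arrangement (family S m) N \<longrightarrow> congruent_arrangement T L N \<longrightarrow>
           (\<forall>A. rotation_matrix A \<longrightarrow> (Phi T z \<iota> N = (*v) A ` X \<longleftrightarrow> N = P X A)) \<and>
           (equivalent_arrangements T z \<iota> N (P X (mat 1)) \<longleftrightarrow>
              (\<exists>Q. orthogonal_matrix Q \<and> N = P X Q)))) \<and>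
     (\<forall>X Y A B. spherical_code \<psi> X \<longrightarrow> spherical_code \<psi> Y \<longrightarrow> isometric_on_sphere X Y \<longrightarrow>
        rotation_matrix A \<longrightarrow> rotation_matrix B \<longrightarrow>
        (\<exists>g. conformal_map g \<and> (\<lambda>C. g ` C) ` P X A = P Y B))"
proof -
  note T = \<open>normalizing (S 1) (S 2) T\<close> and L = \<open>center_set (\<lambda>i. T ` S i) m L\<close>
    and fr = \<open>sphere_frame L z r \<iota>\<close> and \<psi> = \<open>code_angle r \<psi>\<close>
  have b: "bij T" using T by (rule normalizing_bij)
  have P: "P X A = arrangement_of_code T L z \<iota> ((*v) A ` X)" for X A
    by (simp add: P_def rotated_arrangement_def)
  have ot: "orthogonal_transformation ((*v) A)" if "rotation_matrix A" for A :: "real ^ 'd ^ 'd"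
    using that by (simp add: rotation_matrix_def orthogonal_matrix_transformation)
  have sph: "(*v) A ` X \<subseteq> sphere 0 1" if "spherical_code \<psi> X" "orthogonal_matrix A"
    for X and A :: "real ^ 'd ^ 'd"
    using spherical_code_orthogonal_image[OF orthogonal_matrix_transformation[OF that(2)] that(1)]
    by (simp add: spherical_code_def)
  have Phi: "Phi T z \<iota> (P X A) = (*v) A ` X" if "spherical_code \<psi> X" "orthogonal_matrix A" for X A
    unfolding P by (rule Phi_arrangement_of_code[OF b fr sph[OF that]])
  \<comment> \<open>Undo \<open>A\<close>, apply \<open>h\<close>, then apply \<open>B\<close>. With
    h = id this compares two rotations of one code; with an isometry of codes it yields the
    conformal map.\<close>
  have transfer: "\<exists>f. orthogonal_transformation f \<and> f ` (*v) A ` X = (*v) B ` Y"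
    if "rotation_matrix A" "rotation_matrix B" "orthogonal_transformation h" "h ` X = Y"
    for X Y h and A B :: "real ^ 'd ^ 'd"
  proof -
    define f where "f = (*v) B \<circ> h \<circ> inv ((*v) A)"
    have "orthogonal_transformation f"
      unfolding f_def
      by (intro orthogonal_transformation_compose orthogonal_transformation_inv ot that)
    moreover have "f ` (*v) A ` X = (*v) B ` Y"
      using orthogonal_transformation_inj[OF ot[OF that(1)]] that(4)
      by (auto simp: f_def image_image)
    ultimately show ?thesis by blast
  qed
  have m1: "(\<forall>C\<in>P X A. is_sphere C) \<and> tangent_to_all (family S m) (P X A) \<and>
      pairwise_non_intersecting (P X A) \<and>
      (kissing_arrangement (family S m) (P X A) \<longleftrightarrow>
        (\<forall>x\<in>X. \<exists>y\<in>X. y \<noteq> x \<and> angular_dist x y = \<psi>)) \<and>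
      congruent_arrangement T L (P X A) \<and> Phi T z \<iota> (P X A) = (*v) A ` X"
    if X: "spherical_code \<psi> X" and A: "rotation_matrix A" for X A
  proof -
    have oA: "orthogonal_matrix A" using A by (simp add: rotation_matrix_def)
    note oT = ot[OF A]
    note k = kissing_arrangement_of_spherical_code[OF T L fr \<psi> spherical_code_orthogonal_image[OF oT X],
      folded P]
    \<comment> \<open>Rotations preserve angles, so the condition on exact neighbours can be read
      off \<open>X\<close> instead of its rotated copy.\<close>
    have "angular_dist (A *v x) (A *v y) = angular_dist x y" for x y
      using oT by (simp add: angular_dist_def orthogonal_transformation_def)
    then have "(\<forall>x\<in>(*v) A ` X. \<exists>y\<in>(*v) A ` X. y \<noteq> x \<and> angular_dist x y = \<psi>) \<longleftrightarrow>
        (\<forall>x\<in>X. \<exists>y\<in>X. y \<noteq> x \<and> angular_dist x y = \<psi>)"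
      using orthogonal_transformation_inj[OF oT] by (simp add: inj_eq)
    then show ?thesis
      using k Phi[OF X oA] congruent_arrangement_of_code[OF b fr sph[OF X oA], folded P] by simp
  qed
  have m2: "equivalent_arrangements T z \<iota> (P X A) (P X B) \<and>
      (P X A = P X B \<longleftrightarrow> (*v) A ` X = (*v) B ` X)"
    if X: "spherical_code \<psi> X" and "rotation_matrix A" "rotation_matrix B" for X A B
  proof -
    have o: "orthogonal_matrix A" "orthogonal_matrix B" using that by (auto simp: rotation_matrix_def)
    have "equivalent_arrangements T z \<iota> (P X A) (P X B)"
      unfolding equivalent_arrangements_def Phi[OF X o(1)] Phi[OF X o(2)]
        isometric_on_sphere_iff[OF sph[OF X o(1)]]
      using transfer[OF that(2,3) orthogonal_transformation_id] by simp
    \<comment> \<open>\<open>Phi\<close> recovers the rotated code, so two rotations give the same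
      arrangement exactly when they move \<open>X\<close> to the same set.\<close>
    moreover have "P X A = P X B \<longleftrightarrow> (*v) A ` X = (*v) B ` X"
      using Phi[OF X o(1)] Phi[OF X o(2)] P by metis
    ultimately show ?thesis by blast
  qed
  have m3: "(\<forall>A. rotation_matrix A \<longrightarrow> (Phi T z \<iota> N = (*v) A ` X \<longleftrightarrow> N = P X A)) \<and>
      (equivalent_arrangements T z \<iota> N (P X (mat 1)) \<longleftrightarrow>
        (\<exists>Q. orthogonal_matrix Q \<and> N = P X Q))"
    if X: "spherical_code \<psi> X" and N: "congruent_arrangement T L N" for X N
  proof -
    note N' = Phi_congruent_arrangement[OF b fr N]
    \<comment> \<open>Stated for orthogonal matrices, since isometries of codes may reverse
      orientation.\<close>
    have iff: "Phi T z \<iota> N = (*v) Q ` X \<longleftrightarrow> N = P X Q" if "orthogonal_matrix Q" for Q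
      using N'(2) Phi[OF X that] by (metis P)
    have "Phi T z \<iota> (P X (mat 1)) = X"
      using Phi[OF X orthogonal_matrix_id] by simp
    then have "equivalent_arrangements T z \<iota> N (P X (mat 1)) \<longleftrightarrow>
        (\<exists>f. orthogonal_transformation f \<and> f ` Phi T z \<iota> N = X)"
      by (simp add: equivalent_arrangements_def isometric_on_sphere_iff[OF N'(1)])
    \<comment> \<open>Replace \<open>f\<close> by its inverse to express the code of
      \<open>N\<close> through \<open>X\<close>.\<close>
    also have "\<dots> \<longleftrightarrow> (\<exists>f. orthogonal_transformation f \<and> Phi T z \<iota> N = f ` X)"
      by (metis bij_image_inv orthogonal_transformation_bij orthogonal_transformation_inv)
    also have "\<dots> \<longleftrightarrow> (\<exists>Q. orthogonal_matrix Q \<and> Phi T z \<iota> N = (*v) Q ` X)"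
    proof (intro iffI; elim exE conjE)
      fix f assume "orthogonal_transformation f" "Phi T z \<iota> N = f ` X"
      then show "\<exists>Q. orthogonal_matrix Q \<and> Phi T z \<iota> N = (*v) Q ` X"
        by (intro exI[of _ "matrix f"]) (simp add: orthogonal_transformation_matrix)
    qed (blast intro: orthogonal_matrix_transformation)
    finally show ?thesis using iff by (auto simp: rotation_matrix_def)
  qed
  have m4: "\<exists>g. conformal_map g \<and> (\<lambda>C. g ` C) ` P X A = P Y B"
    if X: "spherical_code \<psi> X" and XY: "isometric_on_sphere X Y"
      and AB: "rotation_matrix A" "rotation_matrix B"
    for X Y A B
  proof -
    have "X \<subseteq> sphere 0 1" using X by (simp add: spherical_code_def)
    then obtain h where "orthogonal_transformation h" "h ` X = Y"
      using XY by (auto simp: isometric_on_sphere_iff)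
    then obtain f where f: "orthogonal_transformation f" "f ` (*v) A ` X = (*v) B ` Y"
      using transfer[OF AB] by blast
    have "(*v) A ` X \<subseteq> sphere 0 1" using sph[OF X] AB(1) by (simp add: rotation_matrix_def)
    then obtain g where "conformal_map g"
        "(\<lambda>C. g ` C) ` arrangement_of_code T L z \<iota> ((*v) A ` X) =
          arrangement_of_code T L z \<iota> (f ` (*v) A ` X)"
      using f(1) by (rule conformal_map_between_arrangements[OF T fr])
    then show ?thesis unfolding P f(2) by (intro exI conjI)
  qed
  show ?thesis
    by (rule conjI; intro allI impI)
       (rule conjI, ((intro allI impI)[1], rule m1; assumption),
        rule conjI, ((intro allI impI)[1], rule m2; assumption),
        ((intro allI impI)[1], rule m3; assumption), (rule m4; assumption))
qed

end
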